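(* For any weighted composition operator $C_{w,f}$ on $C_0(\Omega)$, \[ \|(C_{w,f})^n\| = \|w^{(n)}\| \quad \text{for all } n \in \mathbb{N}. \] In particular, $C_{w,f}$ is power-bounded if and only if there is a constant $C \in (0,\infty)$ such that \[ \|w^{(n)}\| \le C \quad \text{for all } n \in \mathbb{N}. \]
   Context: Fix $\mathbb{K} = \mathbb{R}$ or $\mathbb{C}$ and an arbitrary locally compact Hausdorff space $\Omega$. $C_0(\Omega)$ is the Banach space over $\mathbb{K}$ of all continuous maps $\varphi : \Omega \to \mathbb{K}$ vanishing at infinity, with norm $\|\varphi\| = \sup_{x\in\Omega} |\varphi(x)|$; the notation $\|\varphi\| = \sup_{x \in \Omega}|\varphi(x)|$ is used for any bounded $\varphi : \Omega \to \mathbb{K}$ (a supremum over the empty set is $0$). A weighted composition operator on $C_0(\Omega)$ is the map $C_{w,f}(\varphi) = (\varphi\circ f)\cdot w$, where $w : \Omega \to \mathbb{K}$ is continuous and bounded, $f : \Omega \to \Omega$ is continuous, and the set $\{x \in \Omega : f(x) \in K \text{ and } |w(x)| \ge \varepsilon\}$ is compact for every $\varepsilon > 0$ and every compact $K \subset \Omega$; these conditions make $C_{w,f}$ a well-defined bounded linear operator on $C_0(\Omega)$. Put $w^{(1)} = w$ and $w^{(n)} = (w\circ f^{n-1})\cdots(w\circ f)\cdot w$ for $n \ge 2$. An operator $T$ on a Banach space is power-bounded if there is $C \in (0,\infty)$ with $\|T^n\| \le C$ for all $n \in \mathbb{N} = \{1,2,\ldots\}$. *)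

theory Defs
  imports "HOL-Analysis.Analysis"
begin

text \<open>
  The space \<open>\<Omega>\<close> is an abstract topology \<open>X\<close> (so that the empty space is included). The scalar
  field is any type of class \<^class>\<open>real_normed_field\<close>: its norm is multiplicative, so by
  the theorems of Gelfand--Mazur and Ostrowski it is, up to isometric isomorphism, \<open>real\<close> or \<open>complex\<close>, and both are
  instances.
\<close>

definition sup_norm :: "'a topology \<Rightarrow> ('a \<Rightarrow> 'k::real_normed_field) \<Rightarrow> real" where
  "sup_norm X \<phi> = (if topspace X = {} then 0 else (SUP x\<in>topspace X. norm (\<phi> x)))"

text \<open>
  Functions on \<open>topspace X\<close> are represented by functions on the whole type; the value \<open>0\<close> off
  \<open>topspace X\<close> makes this representation unique and compatible with the pointwise operations.
\<close>

definition C0 :: "'a topology \<Rightarrow> ('a \<Rightarrow> 'k::real_normed_field) set" where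
  "C0 X = {\<phi>. continuous_map X euclidean \<phi> \<and>
              (\<forall>\<epsilon>>0. compactin X {x \<in> topspace X. \<epsilon> \<le> norm (\<phi> x)}) \<and>
              (\<forall>x. x \<notin> topspace X \<longrightarrow> \<phi> x = 0)}"

definition C0_operator ::
  "'a topology \<Rightarrow> (('a \<Rightarrow> 'k::real_normed_field) \<Rightarrow> ('a \<Rightarrow> 'k)) \<Rightarrow> bool" where
  "C0_operator X T \<longleftrightarrow>
     (\<forall>\<phi>\<in>C0 X. T \<phi> \<in> C0 X) \<and>
     (\<forall>\<phi>\<in>C0 X. \<forall>\<psi>\<in>C0 X. T (\<lambda>x. \<phi> x + \<psi> x) = (\<lambda>x. T \<phi> x + T \<psi> x)) \<and>
     (\<forall>c. \<forall>\<phi>\<in>C0 X. T (\<lambda>x. c * \<phi> x) = (\<lambda>x. c * T \<phi> x)) \<and>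
     (\<exists>B. \<forall>\<phi>\<in>C0 X. sup_norm X (T \<phi>) \<le> B * sup_norm X \<phi>)"

text \<open>
  The supremum is taken in \<^typ>\<open>real\<close>, so this is the operator norm only when
  \<^term>\<open>C0_operator X T\<close> holds; lemma \<open>C0_operator_wco\<close> below covers weighted
  composition operators.
\<close>

definition op_norm ::
  "'a topology \<Rightarrow> (('a \<Rightarrow> 'k::real_normed_field) \<Rightarrow> ('a \<Rightarrow> 'k)) \<Rightarrow> real" where
  "op_norm X T = (SUP \<phi>\<in>{\<phi> \<in> C0 X. sup_norm X \<phi> \<le> 1}. sup_norm X (T \<phi>))"

definition power_bounded ::
  "'a topology \<Rightarrow> (('a \<Rightarrow> 'k::real_normed_field) \<Rightarrow> ('a \<Rightarrow> 'k)) \<Rightarrow> bool" where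
  "power_bounded X T \<longleftrightarrow>
     C0_operator X T \<and> (\<exists>C>0. \<forall>n\<ge>1. op_norm X (T ^^ n) \<le> C)"

definition wco_symbols :: "'a topology \<Rightarrow> ('a \<Rightarrow> 'k::real_normed_field) \<Rightarrow> ('a \<Rightarrow> 'a) \<Rightarrow> bool" where
  "wco_symbols X w f \<longleftrightarrow>
     continuous_map X euclidean w \<and> bounded (w ` topspace X) \<and> continuous_map X X f \<and>
     (\<forall>\<epsilon>>0. \<forall>K. compactin X K \<longrightarrow>
        compactin X {x \<in> topspace X. f x \<in> K \<and> \<epsilon> \<le> norm (w x)})"

definition wco ::
  "'a topology \<Rightarrow> ('a \<Rightarrow> 'k::real_normed_field) \<Rightarrow> ('a \<Rightarrow> 'a) \<Rightarrow> ('a \<Rightarrow> 'k) \<Rightarrow> ('a \<Rightarrow> 'k)" where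
  "wco X w f \<phi> = (\<lambda>x. if x \<in> topspace X then \<phi> (f x) * w x else 0)"

definition iter_weight :: "('a \<Rightarrow> 'k::real_normed_field) \<Rightarrow> ('a \<Rightarrow> 'a) \<Rightarrow> nat \<Rightarrow> 'a \<Rightarrow> 'k" where
  "iter_weight w f n x = (\<Prod>i<n. w ((f ^^ i) x))"

lemma bounded_C0:
  assumes "\<phi> \<in> C0 X"
  shows "bounded (\<phi> ` topspace X)"
proof -
  let ?S = "{x \<in> topspace X. 1 \<le> norm (\<phi> x)}"
  have "compactin X ?S" "continuous_map X euclidean \<phi>"
    using assms by (auto simp: C0_def)
  then have "compact (\<phi> ` ?S)"
    using image_compactin by fastforce
  then obtain B where "\<And>x. x \<in> ?S \<Longrightarrow> norm (\<phi> x) \<le> B"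
    using compact_imp_bounded bounded_iff by (metis (no_types, lifting) imageI)
  then have "norm (\<phi> x) \<le> max 1 B" if "x \<in> topspace X" for x
    using that by (cases "1 \<le> norm (\<phi> x)") (auto simp: le_max_iff_disj)
  then show ?thesis
    by (auto simp: bounded_iff)
qed

lemma norm_le_sup_norm:
  assumes "bounded (\<phi> ` topspace X)" "x \<in> topspace X"
  shows "norm (\<phi> x) \<le> sup_norm X \<phi>"
proof -
  have "bdd_above ((\<lambda>x. norm (\<phi> x)) ` topspace X)"
    using assms(1) by (auto simp: bounded_iff bdd_above_def)
  then show ?thesis
    using assms(2) by (auto simp: sup_norm_def intro: cSUP_upper)
qed

lemma sup_norm_le:
  assumes "0 \<le> B" "\<And>x. x \<in> topspace X \<Longrightarrow> norm (\<phi> x) \<le> B"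
  shows "sup_norm X \<phi> \<le> B"
  using assms by (auto simp: sup_norm_def intro: cSUP_least)

lemma wco_in_C0:
  assumes "wco_symbols X w f" "\<phi> \<in> C0 X"
  shows "wco X w f \<phi> \<in> C0 X"
proof -
  have w: "continuous_map X euclidean w" "bounded (w ` topspace X)"
    and f: "continuous_map X X f"
    and cpt: "\<And>\<epsilon> K. 0 < \<epsilon> \<Longrightarrow> compactin X K \<Longrightarrow>
      compactin X {x \<in> topspace X. f x \<in> K \<and> \<epsilon> \<le> norm (w x)}"
    using assms(1) by (auto simp: wco_symbols_def)
  have \<phi>: "continuous_map X euclidean \<phi>"
    and van: "\<And>\<epsilon>. 0 < \<epsilon> \<Longrightarrow> compactin X {x \<in> topspace X. \<epsilon> \<le> norm (\<phi> x)}"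
    using assms(2) by (auto simp: C0_def)
  obtain M where M: "0 < M" "\<And>x. x \<in> topspace X \<Longrightarrow> norm (w x) \<le> M"
    using w(2) by (auto simp: bounded_pos)
  obtain N where N: "0 < N" "\<And>x. x \<in> topspace X \<Longrightarrow> norm (\<phi> x) \<le> N"
    using bounded_C0[OF assms(2)] by (auto simp: bounded_pos)
  have fX: "f x \<in> topspace X" if "x \<in> topspace X" for x
    using f that by (auto simp: continuous_map_def)
  have "continuous_map X euclidean (\<phi> \<circ> f)"
    using continuous_map_compose[OF f \<phi>] .
  then have "continuous_map X euclidean (\<lambda>x. \<phi> (f x) * w x)"
    using w(1) by (simp add: continuous_map_atin o_def tendsto_mult)
  then have cont: "continuous_map X euclidean (wco X w f \<phi>)"
    by (rule continuous_map_eq) (simp add: wco_def)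
  have "compactin X {x \<in> topspace X. \<epsilon> \<le> norm (wco X w f \<phi> x)}" if "0 < \<epsilon>" for \<epsilon>
  proof (rule closed_compactin)
    show "compactin X {x \<in> topspace X.
        f x \<in> {x \<in> topspace X. \<epsilon> / M \<le> norm (\<phi> x)} \<and> \<epsilon> / N \<le> norm (w x)}"
      using that M(1) N(1) by (intro cpt van) auto
    show "{x \<in> topspace X. \<epsilon> \<le> norm (wco X w f \<phi> x)} \<subseteq> {x \<in> topspace X.
        f x \<in> {x \<in> topspace X. \<epsilon> / M \<le> norm (\<phi> x)} \<and> \<epsilon> / N \<le> norm (w x)}"
    proof clarsimp
      fix x assume x: "x \<in> topspace X" "\<epsilon> \<le> norm (wco X w f \<phi> x)"
      then have e: "\<epsilon> \<le> norm (\<phi> (f x)) * norm (w x)"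
        by (simp add: wco_def norm_mult)
      have "norm (\<phi> (f x)) * norm (w x) \<le> norm (\<phi> (f x)) * M"
           "norm (\<phi> (f x)) * norm (w x) \<le> N * norm (w x)"
        using M(2)[OF x(1)] N(2)[OF fX[OF x(1)]] by (auto intro: mult_left_mono mult_right_mono)
      with e have "\<epsilon> \<le> norm (\<phi> (f x)) * M" "\<epsilon> \<le> N * norm (w x)"
        by linarith+
      then show "f x \<in> topspace X \<and> \<epsilon> / M \<le> norm (\<phi> (f x)) \<and> \<epsilon> / N \<le> norm (w x)"
        using M(1) N(1) fX[OF x(1)] by (simp add: field_simps)
    qed
    have "closed {z :: 'b. \<epsilon> \<le> norm z}"
      by (intro closed_Collect_le continuous_intros)
    then show "closedin X {x \<in> topspace X. \<epsilon> \<le> norm (wco X w f \<phi> x)}"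
      using closedin_continuous_map_preimage[OF cont, of "{z. \<epsilon> \<le> norm z}"] by simp
  qed
  with cont show ?thesis
    by (auto simp: C0_def wco_def)
qed

lemma C0_operator_wco:
  assumes "wco_symbols X w f"
  shows "C0_operator X (wco X w f)"
proof -
  have "sup_norm X (wco X w f \<phi>) \<le> sup_norm X w * sup_norm X \<phi>" if "\<phi> \<in> C0 X" for \<phi>
  proof (cases "topspace X = {}")
    case True
    then show ?thesis by (simp add: sup_norm_def)
  next
    case False
    have w: "\<And>x. x \<in> topspace X \<Longrightarrow> norm (w x) \<le> sup_norm X w"
      using assms by (auto simp: wco_symbols_def intro: norm_le_sup_norm)
    have p: "\<And>x. x \<in> topspace X \<Longrightarrow> norm (\<phi> x) \<le> sup_norm X \<phi>"
      using that by (auto intro: norm_le_sup_norm bounded_C0)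
    have nn: "0 \<le> sup_norm X w" "0 \<le> sup_norm X \<phi>"
      using False w p by (meson all_not_in_conv norm_ge_zero order_trans)+
    have "f x \<in> topspace X" if "x \<in> topspace X" for x
      using assms that by (auto simp: wco_symbols_def continuous_map_def)
    then show ?thesis
      using w p nn
      by (intro sup_norm_le) (auto simp: wco_def norm_mult mult.commute[of "sup_norm X w"] intro!: mult_mono)
  qed
  then have "\<exists>B. \<forall>\<phi>\<in>C0 X. sup_norm X (wco X w f \<phi>) \<le> B * sup_norm X \<phi>"
    by blast
  moreover have "wco X w f (\<lambda>x. \<phi> x + \<psi> x) = (\<lambda>x. wco X w f \<phi> x + wco X w f \<psi> x)"
    "wco X w f (\<lambda>x. c * \<phi> x) = (\<lambda>x. c * wco X w f \<phi> x)" for \<phi> \<psi> c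
    by (auto simp: wco_def algebra_simps)
  ultimately show ?thesis
    unfolding C0_operator_def using wco_in_C0[OF assms] by blast
qed

end

theory Submission imports Defs begin

text \<open>
  By induction, \<open>C\<^sub>w\<^sub>,\<^sub>f\<^sup>n \<phi> = (\<phi> \<circ> f\<^sup>n) \<cdot> w\<^sup>(\<^sup>n\<^sup>)\<close>, which gives the upper bound at once. For the lower bound
  at a point \<open>x\<close>, evaluate at \<open>x\<close> the image of a Urysohn function of norm at most 1 that takes the value
  1 at \<open>f\<^sup>n x\<close>.
\<close>

lemma sup_norm_nonneg:
  assumes "bounded (\<phi> ` topspace X)"
  shows "0 \<le> sup_norm X \<phi>"
proof (cases "topspace X = {}")
  case False
  then obtain x where "x \<in> topspace X" by blast
  then show ?thesis
    using norm_le_sup_norm[OF assms] norm_ge_zero order_trans by blast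
qed (simp add: sup_norm_def)

lemma zero_in_C0: "(\<lambda>x. 0) \<in> C0 X"
  by (simp add: C0_def)

text \<open>Local compactness puts an open \<open>U\<close> around \<open>p\<close> inside a compact
  \<open>K\<close>, and complete regularity separates \<open>p\<close> from the complement of
  \<open>U\<close>. The resulting function vanishes off \<open>U\<close>, so each set where its norm
  is at least a positive \<open>\<epsilon>\<close> is a closed subset of \<open>K\<close>, hence
  compact.\<close>

lemma C0_bump:
  fixes X :: "'a topology"
  assumes "Hausdorff_space X" "locally_compact_space X" "p \<in> topspace X"
  obtains \<phi> :: "'a \<Rightarrow> 'k::real_normed_field"
  where "\<phi> \<in> C0 X" "sup_norm X \<phi> \<le> 1" "\<phi> p = 1"
proof -
  obtain U K where U: "openin X U" and K: "compactin X K" and pU: "p \<in> U" and UK: "U \<subseteq> K"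
    using assms(2,3) unfolding locally_compact_space_def by blast
  have "completely_regular_space X"
    using assms(1,2) locally_compact_Hausdorff_imp_regular_space
      locally_compact_regular_imp_completely_regular_space by blast
  moreover have "closedin X (topspace X - U)" "p \<in> topspace X - (topspace X - U)"
    using U pU assms(3) by auto
  ultimately obtain g :: "'a \<Rightarrow> real" where g: "continuous_map X (top_of_set {0..1}) g" "g p = 0"
      and g1: "g ` (topspace X - U) \<subseteq> {1}"
    unfolding completely_regular_space_def by blast
  have gc: "continuous_map X euclidean g" and g01: "\<And>x. x \<in> topspace X \<Longrightarrow> g x \<in> {0..1}"
    using g(1) by (auto simp: continuous_map_in_subtopology)
  \<comment> \<open>The separating \<open>g\<close> is 0 at \<open>p\<close> and 1 off
    \<open>U\<close>, hence the flip to \<open>1 - g x\<close>; the value 0 off the space is what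
    \<open>C0\<close> demands.\<close>
  define \<phi> :: "'a \<Rightarrow> 'k" where "\<phi> x = (if x \<in> topspace X then of_real (1 - g x) else 0)" for x
  have "continuous_map X euclidean (\<lambda>x. of_real (1 - g x) :: 'k)"
    using gc by (simp add: continuous_map_atin tendsto_intros)
  then have cont: "continuous_map X euclidean \<phi>"
    by (rule continuous_map_eq) (simp add: \<phi>_def)
  have "compactin X {x \<in> topspace X. \<epsilon> \<le> norm (\<phi> x)}" if "0 < \<epsilon>" for \<epsilon>
  proof (rule closed_compactin[OF K])
    show "{x \<in> topspace X. \<epsilon> \<le> norm (\<phi> x)} \<subseteq> K"
    proof clarify
      fix x assume x: "x \<in> topspace X" "\<epsilon> \<le> norm (\<phi> x)"
      then have "g x \<noteq> 1"
        using that by (auto simp: \<phi>_def)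
      with g1 x(1) UK show "x \<in> K" by blast
    qed
    have "closed {z :: 'k. \<epsilon> \<le> norm z}"
      by (intro closed_Collect_le continuous_intros)
    then show "closedin X {x \<in> topspace X. \<epsilon> \<le> norm (\<phi> x)}"
      using closedin_continuous_map_preimage[OF cont, of "{z. \<epsilon> \<le> norm z}"] by simp
  qed
  with cont have "\<phi> \<in> C0 X"
    by (simp add: C0_def \<phi>_def)
  \<comment> \<open>Keeping \<open>of_real (1 - g x)\<close> unsplit lets its norm reduce to the
    absolute value of \<open>1 - g x\<close>.\<close>
  moreover have "sup_norm X \<phi> \<le> 1"
    using g01 by (intro sup_norm_le) (auto simp: \<phi>_def simp del: of_real_diff)
  moreover have "\<phi> p = 1"
    using assms(3) g(2) by (simp add: \<phi>_def)
  ultimately show thesis ..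
qed

lemma funpow_in_topspace:
  assumes "continuous_map X X f" "x \<in> topspace X"
  shows "(f ^^ n) x \<in> topspace X"
  using assms by (induction n) (auto simp: continuous_map_def)

lemma funpow_wco_in_C0:
  assumes "wco_symbols X w f" "\<phi> \<in> C0 X"
  shows "(wco X w f ^^ n) \<phi> \<in> C0 X"
  using assms by (induction n) (auto intro: wco_in_C0)

text \<open>Splits off the factor \<open>i = 0\<close> rather than the last one, because one
  application of \<open>wco\<close> multiplies by \<open>w x\<close> and moves the evaluation to
  \<open>f x\<close>.\<close>

lemma iter_weight_Suc: "iter_weight w f (Suc n) x = w x * iter_weight w f n (f x)"
  unfolding iter_weight_def by (subst prod.lessThan_Suc_shift) (simp add: funpow_swap1)

lemma funpow_wco_apply:
  assumes "wco_symbols X w f" "x \<in> topspace X"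
  shows "(wco X w f ^^ n) \<phi> x = \<phi> ((f ^^ n) x) * iter_weight w f n x"
  using assms(2)
\<comment> \<open>The outermost \<open>wco\<close> evaluates the remaining power at
  \<open>f x\<close>, so the point has to vary.\<close>
proof (induction n arbitrary: x)
  case 0
  then show ?case by (simp add: iter_weight_def)
next
  case (Suc n)
  have "f x \<in> topspace X"
    using assms(1) Suc.prems by (auto simp: wco_symbols_def continuous_map_def)
  then show ?case
    using Suc by (simp add: wco_def iter_weight_Suc funpow_swap1 mult_ac)
qed

text \<open>Orbits stay in the space, so each of the \<open>n\<close> factors is at most a bound
  \<open>M\<close> of \<open>w\<close>. This makes \<open>sup_norm\<close> of the iterated weight a
  genuine supremum.\<close>

lemma bounded_iter_weight:
  assumes "wco_symbols X w f"
  shows "bounded (iter_weight w f n ` topspace X)"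
proof -
  have f: "continuous_map X X f" and "bounded (w ` topspace X)"
    using assms by (auto simp: wco_symbols_def)
  then obtain M where M: "\<And>x. x \<in> topspace X \<Longrightarrow> norm (w x) \<le> M"
    by (auto simp: bounded_iff)
  have "norm (iter_weight w f n x) \<le> M ^ n" if "x \<in> topspace X" for x
  proof -
    have "(\<Prod>i<n. norm (w ((f ^^ i) x))) \<le> (\<Prod>i<n. M)"
      using funpow_in_topspace[OF f that] M by (intro prod_mono) auto
    then show ?thesis by (simp add: iter_weight_def prod_norm)
  qed
  then show ?thesis by (auto simp: bounded_iff)
qed

text \<open>Serves twice: as the upper estimate of the operator norm, and as the proof that the set
  whose supremum defines \<open>op_norm\<close> is bounded above.\<close>

lemma sup_norm_funpow_wco_le:
  assumes "wco_symbols X w f" "\<phi> \<in> C0 X" "sup_norm X \<phi> \<le> 1"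
  shows "sup_norm X ((wco X w f ^^ n) \<phi>) \<le> sup_norm X (iter_weight w f n)"
proof (rule sup_norm_le)
  show "0 \<le> sup_norm X (iter_weight w f n)"
    by (intro sup_norm_nonneg bounded_iter_weight assms)
  fix x assume x: "x \<in> topspace X"
  have "(f ^^ n) x \<in> topspace X"
    using assms(1) x by (auto simp: wco_symbols_def intro: funpow_in_topspace)
  then have "norm (\<phi> ((f ^^ n) x)) \<le> 1"
    using norm_le_sup_norm[OF bounded_C0[OF assms(2)]] assms(3) order_trans by blast
  moreover have "norm (iter_weight w f n x) \<le> sup_norm X (iter_weight w f n)"
    by (intro norm_le_sup_norm bounded_iter_weight assms x)
  ultimately have "norm (\<phi> ((f ^^ n) x)) * norm (iter_weight w f n x)
      \<le> 1 * sup_norm X (iter_weight w f n)"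
    by (intro mult_mono) auto
  then show "norm ((wco X w f ^^ n) \<phi> x) \<le> sup_norm X (iter_weight w f n)"
    by (simp add: funpow_wco_apply[OF assms(1) x] norm_mult)
qed

lemma op_norm_funpow_wco:
  fixes w :: "'a \<Rightarrow> 'k::real_normed_field"
  assumes "Hausdorff_space X" "locally_compact_space X" "wco_symbols X w f"
  shows "op_norm X (wco X w f ^^ n) = sup_norm X (iter_weight w f n)"
proof (rule antisym)
  let ?T = "wco X w f ^^ n"
  \<comment> \<open>The zero function shows that the unit ball is nonempty, as a least-upper-bound
    argument in \<open>real\<close> requires; it also yields \<open>0 \<le> op_norm X ?T\<close>
    below, even over the empty space.\<close>
  have zero: "(\<lambda>x. 0) \<in> {\<phi> \<in> C0 X. sup_norm X (\<phi> :: 'a \<Rightarrow> 'k) \<le> 1}"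
    by (auto simp: zero_in_C0 intro: sup_norm_le)
  then show "op_norm X ?T \<le> sup_norm X (iter_weight w f n)"
    unfolding op_norm_def
    by (intro cSUP_least) (auto intro: sup_norm_funpow_wco_le[OF assms(3)])
  have upper: "sup_norm X (?T \<phi>) \<le> op_norm X ?T" if "\<phi> \<in> C0 X" "sup_norm X \<phi> \<le> 1" for \<phi>
    unfolding op_norm_def using that sup_norm_funpow_wco_le[OF assms(3)]
    by (intro cSUP_upper) (auto simp: bdd_above_def)
  have bdd: "bounded (?T \<phi> ` topspace X)" if "\<phi> \<in> C0 X" for \<phi>
    by (intro bounded_C0 funpow_wco_in_C0 assms that)
  show "sup_norm X (iter_weight w f n) \<le> op_norm X ?T"
  proof (rule sup_norm_le)
    show "0 \<le> op_norm X ?T"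
      using zero upper bdd sup_norm_nonneg order_trans by blast
    fix x assume x: "x \<in> topspace X"
    then have "(f ^^ n) x \<in> topspace X"
      using assms(3) by (auto simp: wco_symbols_def intro: funpow_in_topspace)
    then obtain \<phi> :: "'a \<Rightarrow> 'k"
      where \<phi>: "\<phi> \<in> C0 X" "sup_norm X \<phi> \<le> 1" "\<phi> ((f ^^ n) x) = 1"
      using C0_bump assms(1,2) by metis
    \<comment> \<open>The factor \<open>\<phi> ((f ^^ n) x)\<close> equals 1, so only the weight
      remains.\<close>
    then have "norm (iter_weight w f n x) = norm (?T \<phi> x)"
      by (simp add: funpow_wco_apply[OF assms(3) x])
    also have "\<dots> \<le> sup_norm X (?T \<phi>)"
      by (intro norm_le_sup_norm bdd \<phi> x)
    also have "\<dots> \<le> op_norm X ?T"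
      by (intro upper \<phi>)
    finally show "norm (iter_weight w f n x) \<le> op_norm X ?T" .
  qed
qed

theorem theorem15:
  fixes X :: "'a topology" and w :: "'a \<Rightarrow> 'k::real_normed_field" and f :: "'a \<Rightarrow> 'a"
  assumes "Hausdorff_space X" and "locally_compact_space X"
    and "wco_symbols X w f"
  shows "(\<forall>n\<ge>1. op_norm X (wco X w f ^^ n) = sup_norm X (iter_weight w f n)) \<and>
    (power_bounded X (wco X w f) \<longleftrightarrow>
      (\<exists>C>0. \<forall>n\<ge>1. sup_norm X (iter_weight w f n) \<le> C))"
  \<comment> \<open>\<open>power_bounded\<close> also asks for a bounded linear operator on
    \<open>C0 X\<close>, which \<open>C0_operator_wco\<close> provides; the bounds on the powers
    then agree by the norm equality.\<close>
  using op_norm_funpow_wco[OF assms] C0_operator_wco[OF assms(3)]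
  by (simp add: power_bounded_def)

end
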